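(* Let $\ell\ge3$, let $\lambda$ be an $\ell$-regular partition and $i$ a residue. Then the $i$-signature of $\lambda$ (and hence its reduced $i$-signature) equals the word obtained by writing $+$ for each addable $i$-box and $-$ for each removable $i$-box of $\lambda$, reading the ladders from leftmost to rightmost and, within each ladder, from bottom to top.
   Context: An $\ell$-regular partition has no nonzero part repeated $\ell$ or more times. Young diagrams in English notation; $(a,b)$ is the box in row $a$, column $b$, residue $b-a\bmod\ell$. Removable (resp. addable) $i$-box: a box in $\lambda$ (resp. position not in $\lambda$) of residue $i$ whose removal (resp. addition) yields a partition. The $i$-signature of $\lambda$ is the word with $+$ for each addable $i$-box and $-$ for each removable $i$-box, read from bottom left to top right, i.e. in order of decreasing row index; the reduced $i$-signature is obtained by repeatedly deleting adjacent pairs "$-+$". The ladder of $(a,b)$ is the set of positions $(c,d)$, $c,d\ge1$, with $c+(\ell-1)d=a+(\ell-1)b$; ladders are ordered from left to right by increasing $c+(\ell-1)d$; within a ladder, "bottom to top" means decreasing row index. *)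

theory Defs
  imports Main
begin

text \<open>A partition is the weakly decreasing list of its nonzero parts. Boxes are 1-based pairs
  (row, column), with rows numbered from top to bottom.\<close>

type_synonym box = "nat \<times> nat"

definition partition :: "nat list \<Rightarrow> bool" where
  "partition \<mu> \<longleftrightarrow> sorted_wrt (\<ge>) \<mu> \<and> 0 \<notin> set \<mu>"

definition regular_partition :: "nat \<Rightarrow> nat list \<Rightarrow> bool" where
  "regular_partition l \<mu> \<longleftrightarrow> partition \<mu> \<and> (\<forall>p \<in> set \<mu>. count_list \<mu> p < l)"

definition diagram :: "nat list \<Rightarrow> box set" where
  "diagram \<mu> = {(a, b). 1 \<le> a \<and> a \<le> length \<mu> \<and> 1 \<le> b \<and> b \<le> \<mu> ! (a - 1)}"

definition residue :: "nat \<Rightarrow> box \<Rightarrow> int" where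
  "residue l = (\<lambda>(a, b). (int b - int a) mod int l)"

definition removable :: "nat list \<Rightarrow> box \<Rightarrow> bool" where
  "removable \<mu> x \<longleftrightarrow> x \<in> diagram \<mu> \<and> (\<exists>\<nu>. partition \<nu> \<and> diagram \<nu> = diagram \<mu> - {x})"

definition addable :: "nat list \<Rightarrow> box \<Rightarrow> bool" where
  "addable \<mu> x \<longleftrightarrow> x \<notin> diagram \<mu> \<and> (\<exists>\<nu>. partition \<nu> \<and> diagram \<nu> = insert x (diagram \<mu>))"

definition signature_boxes :: "nat \<Rightarrow> int \<Rightarrow> nat list \<Rightarrow> box set" where
  "signature_boxes l i \<mu> = {x. (addable \<mu> x \<or> removable \<mu> x) \<and> residue l x = i}"

datatype sign = Plus | Minus

definition box_sign :: "nat list \<Rightarrow> box \<Rightarrow> sign" where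
  "box_sign \<mu> x = (if addable \<mu> x then Plus else Minus)"

text \<open>Boxes of a finite set by decreasing row index. This is only meaningful for sets with at most
  one box in each row, such as \<open>signature_boxes l i \<mu>\<close>
  (see \<open>finite_signature_boxes\<close> and \<open>inj_on_row_signature_boxes\<close> below) and ladders.\<close>

definition bottom_to_top :: "box set \<Rightarrow> box list" where
  "bottom_to_top S = sorted_key_list_of_set (\<lambda>x. - int (fst x)) S"

definition signature :: "nat \<Rightarrow> int \<Rightarrow> nat list \<Rightarrow> sign list" where
  "signature l i \<mu> = map (box_sign \<mu>) (bottom_to_top (signature_boxes l i \<mu>))"

inductive cancel :: "sign list \<Rightarrow> sign list \<Rightarrow> bool" where
  "cancel (u @ [Minus, Plus] @ v) (u @ v)"

text \<open>The normal form exists and is unique: see \<open>reduced_word_unique\<close> below.\<close>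

definition reduced_word :: "sign list \<Rightarrow> sign list" where
  "reduced_word w = (THE r. cancel\<^sup>*\<^sup>* w r \<and> (\<nexists>r'. cancel r r'))"

definition reduced_signature :: "nat \<Rightarrow> int \<Rightarrow> nat list \<Rightarrow> sign list" where
  "reduced_signature l i \<mu> = reduced_word (signature l i \<mu>)"

definition ladder_number :: "nat \<Rightarrow> box \<Rightarrow> nat" where
  "ladder_number l = (\<lambda>(c, d). c + (l - 1) * d)"

text \<open>The ladder of a box \<open>x\<close> is \<open>ladder l (ladder_number l x)\<close>.\<close>

definition ladder :: "nat \<Rightarrow> nat \<Rightarrow> box set" where
  "ladder l n = {(c, d). 1 \<le> c \<and> 1 \<le> d \<and> ladder_number l (c, d) = n}"

text \<open>Only the finitely many ladders containing an addable or removable \<open>i\<close>-box are listed; the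
  others contribute the empty word.\<close>

definition ladder_word :: "nat \<Rightarrow> int \<Rightarrow> nat list \<Rightarrow> sign list" where
  "ladder_word l i \<mu> =
     concat (map (\<lambda>n. map (box_sign \<mu>) (bottom_to_top (signature_boxes l i \<mu> \<inter> ladder l n)))
       (sorted_list_of_set (ladder_number l ` signature_boxes l i \<mu>)))"


subsection \<open>Well-definedness\<close>

fun stack_reduce :: "sign list \<Rightarrow> sign list" where
  "stack_reduce [] = []"
| "stack_reduce (Plus # w) = Plus # stack_reduce w"
| "stack_reduce (Minus # w) =
     (case stack_reduce w of Plus # r \<Rightarrow> r | r \<Rightarrow> Minus # r)"

lemma stack_reduce_cancel: "cancel w w' \<Longrightarrow> stack_reduce w = stack_reduce w'"
proof (induction rule: cancel.induct)
  case (1 u v)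
  show ?case
  proof (induction u)
    case (Cons s u)
    then show ?case by (cases s) auto
  qed simp
qed

lemma stack_reduce_normal: "(\<nexists>r'. cancel r r') \<Longrightarrow> stack_reduce r = r"
proof (induction r)
  case (Cons s r)
  have "\<nexists>r'. cancel r r'"
  proof
    assume "\<exists>r'. cancel r r'"
    then obtain u v where "r = u @ [Minus, Plus] @ v" by (auto elim: cancel.cases)
    then have "cancel (s # r) ((s # u) @ v)" using cancel.intros[of "s # u" v] by simp
    then show False using Cons.prems by blast
  qed
  then have IH: "stack_reduce r = r" by (rule Cons.IH)
  show ?case
  proof (cases s)
    case Minus
    have "r \<noteq> Plus # t" for t
      using Cons.prems cancel.intros[of "[]" t] Minus by auto
    then show ?thesis using IH Minus by (auto split: list.splits sign.splits)
  qed (use IH in simp)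
qed simp

lemma reduced_word_unique: "\<exists>!r. cancel\<^sup>*\<^sup>* w r \<and> (\<nexists>r'. cancel r r')"
proof (rule ex_ex1I)
  show "\<exists>r. cancel\<^sup>*\<^sup>* w r \<and> (\<nexists>r'. cancel r r')"
  proof (induction w rule: length_induct)
    case (1 w)
    show ?case
    proof (cases "\<exists>w'. cancel w w'")
      case True
      then obtain w' where w': "cancel w w'" by blast
      then have "length w' < length w" by (auto elim: cancel.cases)
      with 1 obtain r where "cancel\<^sup>*\<^sup>* w' r" "\<nexists>r'. cancel r r'" by blast
      with w' show ?thesis by (meson converse_rtranclp_into_rtranclp)
    qed blast
  qed
next
  have "stack_reduce w = r" if "cancel\<^sup>*\<^sup>* w r" "\<nexists>r'. cancel r r'" for r
  proof -
    from that(1) have "stack_reduce w = stack_reduce r"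
      by induction (auto dest: stack_reduce_cancel)
    then show ?thesis using stack_reduce_normal that(2) by simp
  qed
  then show "\<And>r r'. cancel\<^sup>*\<^sup>* w r \<and> (\<nexists>s. cancel r s) \<Longrightarrow> cancel\<^sup>*\<^sup>* w r' \<and> (\<nexists>s. cancel r' s) \<Longrightarrow> r = r'"
    by blast
qed

definition row_length :: "nat list \<Rightarrow> nat \<Rightarrow> nat" where
  "row_length \<mu> a = (if 1 \<le> a \<and> a \<le> length \<mu> then \<mu> ! (a - 1) else 0)"

lemma diagram_iff: "(a, b) \<in> diagram \<mu> \<longleftrightarrow> 1 \<le> b \<and> b \<le> row_length \<mu> a"
  by (auto simp: diagram_def row_length_def)

lemma row_length_antimono:
  assumes "partition \<mu>" "1 \<le> a" "a \<le> a'"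
  shows "row_length \<mu> a' \<le> row_length \<mu> a"
  using assms sorted_wrt_nth_less[of "(\<ge>)" \<mu> "a - 1" "a' - 1"]
  by (cases "a = a'") (auto simp: partition_def row_length_def)

lemma diagram_box_unique:
  assumes "x \<notin> D" "D = diagram \<mu>" "insert x D = diagram \<nu>"
  shows "snd x = row_length \<mu> (fst x) + 1" "row_length \<nu> (fst x) = row_length \<mu> (fst x) + 1"
    "\<And>a. a \<noteq> fst x \<Longrightarrow> row_length \<nu> a = row_length \<mu> a"
proof -
  obtain a b where x: "x = (a, b)" by (cases x)
  have iff: "1 \<le> d \<and> d \<le> row_length \<nu> c \<longleftrightarrow> (c, d) = (a, b) \<or> 1 \<le> d \<and> d \<le> row_length \<mu> c" for c d
    using assms x diagram_iff by (metis insert_iff)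
  have notin: "\<not> (1 \<le> b \<and> b \<le> row_length \<mu> a)"
    using assms x diagram_iff by metis
  have b: "1 \<le> b" "b \<le> row_length \<nu> a" using iff[of b a] by auto
  have gt: "row_length \<mu> a < b" using notin b by simp
  have le: "row_length \<nu> a = b"
    using iff[of "row_length \<nu> a" a] b gt by auto
  have "b - 1 \<le> row_length \<mu> a"
    using iff[of "b - 1" a] b by (cases "b = 1") auto
  then have 1: "b = row_length \<mu> a + 1" using gt by simp
  show "snd x = row_length \<mu> (fst x) + 1" using 1 x by simp
  show "row_length \<nu> (fst x) = row_length \<mu> (fst x) + 1" using 1 le x by simp
  show "row_length \<nu> c = row_length \<mu> c" if "c \<noteq> fst x" for c
  proof (rule antisym)
    show "row_length \<nu> c \<le> row_length \<mu> c"
      using iff[of "row_length \<nu> c" c] that x by (cases "row_length \<nu> c = 0") auto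
    show "row_length \<mu> c \<le> row_length \<nu> c"
      using iff[of "row_length \<mu> c" c] that x by (cases "row_length \<mu> c = 0") auto
  qed
qed

lemma row_length_pos: "1 \<le> row_length \<mu> a \<Longrightarrow> 1 \<le> a \<and> a \<le> length \<mu>"
  by (auto simp: row_length_def split: if_splits)

lemma addable_box:
  assumes "addable \<mu> (a, b)"
  shows "b = row_length \<mu> a + 1" "1 \<le> a" "a \<le> length \<mu> + 1"
proof -
  from assms obtain \<nu> where \<nu>: "(a, b) \<notin> diagram \<mu>" "partition \<nu>"
    "insert (a, b) (diagram \<mu>) = diagram \<nu>" by (auto simp: addable_def)
  note box = diagram_box_unique[OF \<nu>(1) refl \<nu>(3), simplified]
  show "b = row_length \<mu> a + 1" using box(1) by simp
  show "1 \<le> a" using row_length_pos[of \<nu> a] box(2) by simp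
  show "a \<le> length \<mu> + 1"
  proof (rule ccontr)
    assume *: "\<not> a \<le> length \<mu> + 1"
    then have "row_length \<nu> a \<le> row_length \<nu> (a - 1)"
      by (intro row_length_antimono \<nu>) auto
    moreover have "row_length \<nu> (a - 1) = row_length \<mu> (a - 1)" using box(3) * by simp
    moreover have "row_length \<mu> (a - 1) = 0" using * by (auto simp: row_length_def)
    ultimately show False using box(2) by simp
  qed
qed

lemma removable_box:
  assumes "removable \<mu> (a, b)"
  shows "b = row_length \<mu> a" "1 \<le> a" "a \<le> length \<mu>"
proof -
  from assms obtain \<nu> where \<nu>: "(a, b) \<in> diagram \<mu>" "partition \<nu>"
    "diagram \<nu> = diagram \<mu> - {(a, b)}" by (auto simp: removable_def)
  then have "(a, b) \<notin> diagram \<nu>" "insert (a, b) (diagram \<nu>) = diagram \<mu>" by auto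
  note box = diagram_box_unique[OF this(1) refl this(2), simplified]
  show "b = row_length \<mu> a" using box by simp
  show "1 \<le> a" "a \<le> length \<mu>" using row_length_pos[of \<mu> a] box by simp_all
qed

lemma finite_signature_boxes: "finite (signature_boxes l i \<mu>)"
proof (rule finite_subset)
  show "signature_boxes l i \<mu> \<subseteq>
      (\<lambda>a. (a, row_length \<mu> a)) ` {..length \<mu> + 1} \<union> (\<lambda>a. (a, row_length \<mu> a + 1)) ` {..length \<mu> + 1}"
  proof
    fix x assume x: "x \<in> signature_boxes l i \<mu>"
    obtain a b where [simp]: "x = (a, b)" by (cases x)
    have "a \<le> length \<mu> + 1" "b = row_length \<mu> a \<or> b = row_length \<mu> a + 1"
      using x addable_box[of \<mu> a b] removable_box[of \<mu> a b] by (auto simp: signature_boxes_def)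
    then show "x \<in> (\<lambda>a. (a, row_length \<mu> a)) ` {..length \<mu> + 1}
        \<union> (\<lambda>a. (a, row_length \<mu> a + 1)) ` {..length \<mu> + 1}"
      by auto
  qed
qed simp

lemma inj_on_row_signature_boxes:
  assumes "2 \<le> l"
  shows "inj_on fst (signature_boxes l i \<mu>)"
proof (rule inj_onI)
  fix x y assume xy: "x \<in> signature_boxes l i \<mu>" "y \<in> signature_boxes l i \<mu>" "fst x = fst y"
  obtain a b c where [simp]: "x = (a, b)" "y = (a, c)" using xy(3) by (cases x, cases y) auto
  have "b \<in> {row_length \<mu> a, row_length \<mu> a + 1}" "c \<in> {row_length \<mu> a, row_length \<mu> a + 1}"
    using xy by (auto simp: signature_boxes_def dest: addable_box removable_box)
  then have "\<bar>int b - int c\<bar> \<le> 1" by auto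
  moreover have "(int b - int a) mod int l = (int c - int a) mod int l"
    using xy by (auto simp: signature_boxes_def residue_def)
  then have "int l dvd int b - int c"
    by (metis add_diff_cancel_right diff_add_cancel mod_eq_dvd_iff)
  ultimately have "int b - int c = 0"
    using assms dvd_imp_le_int[of "int b - int c" "int l"] by force
  then show "x = y" by simp
qed

end

theory Submission
  imports Defs
begin

text \<open>Let \<open>r a\<close> be the length of row \<open>a\<close>. A positive length is repeated at most \<open>l - 1\<close> times, so
  going up \<open>k\<close> rows lengthens the row by at least \<open>k div (l - 1)\<close>. Take signature boxes \<open>(a, b)\<close> and
  \<open>(c, d)\<close> with \<open>a < c\<close>, and suppose that the lower one lies on a ladder strictly to the right, that
  is, \<open>c - a > (l - 1) (b - d)\<close>. Equality of the residues improves this to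
  \<open>c - a \<ge> (l - 1) (b - d) + l\<close>, which contradicts the growth of the rows between \<open>a\<close> and \<open>c\<close>
  (between \<open>a + 1\<close> and \<open>c\<close> when \<open>(a, b)\<close> is removable). Hence the ladder number is weakly decreasing
  in the row index on the signature boxes, and both readings list them in the same order.\<close>

lemma sorted_wrt_concat:
  assumes "\<And>xs. xs \<in> set xss \<Longrightarrow> sorted_wrt R xs"
    and "sorted_wrt (\<lambda>xs ys. \<forall>x\<in>set xs. \<forall>y\<in>set ys. R x y) xss"
  shows "sorted_wrt R (concat xss)"
  using assms by (induction xss) (auto simp: sorted_wrt_append)

text \<open>For \<open>f\<close> the negated row index and \<open>g\<close> the ladder number, the
  right-hand side is the reading ladder by ladder. The concatenation has strictly increasing
  \<open>f\<close> and the entries of \<open>S\<close>, which determines it.\<close>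

lemma (in linorder) sorted_key_list_of_set_fibres:
  fixes f :: "'b \<Rightarrow> 'a" and g :: "'b \<Rightarrow> 'c::linorder"
  assumes fin: "finite S" and inj: "inj_on f S"
    and mono: "\<And>x y. x \<in> S \<Longrightarrow> y \<in> S \<Longrightarrow> f x < f y \<Longrightarrow> g x \<le> g y"
  shows "sorted_key_list_of_set f S =
    concat (map (\<lambda>n. sorted_key_list_of_set f {x \<in> S. g x = n}) (sorted_list_of_set (g ` S)))"
    (is "_ = ?ys")
proof -
  interpret folding_insort_key "(\<le>)" "(<)" S f
    by standard (rule inj)
  let ?F = "\<lambda>n. sorted_key_list_of_set f {x \<in> S. g x = n}"
  have set_F: "set (?F n) = {x \<in> S. g x = n}" for n
    using fin by (intro set_sorted_key_list_of_set) auto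
  have "sorted_wrt (\<lambda>m n. \<forall>x\<in>set (?F m). \<forall>y\<in>set (?F n). f x < f y) (sorted_list_of_set (g ` S))"
  proof (rule sorted_wrt_mono_rel[OF _ linorder_class.strict_sorted_list_of_set])
    fix m n :: 'c assume "m < n"
    show "\<forall>x\<in>set (?F m). \<forall>y\<in>set (?F n). f x < f y"
    proof (intro ballI)
      fix x y assume "x \<in> set (?F m)" "y \<in> set (?F n)"
      then have xy: "x \<in> S" "y \<in> S" "g x < g y" using \<open>m < n\<close> by (auto simp: set_F)
      \<comment> \<open>\<open>mono\<close> alone yields only \<open>f x \<le> f y\<close>;
        injectivity excludes ties between different fibres.\<close>
      then have "f x \<noteq> f y" using inj by (auto dest: inj_onD)
      moreover have "\<not> f y < f x" using mono[OF xy(2,1)] xy(3) by auto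
      ultimately show "f x < f y" by simp
    qed
  qed
  moreover have "sorted_wrt (\<lambda>x y. f x < f y) (?F n)" for n
    using strict_sorted_key_list_of_set[of "{x \<in> S. g x = n}"] by (simp add: sorted_wrt_map)
  ultimately have "sorted_wrt (\<lambda>x y. f x < f y) ?ys"
    by (intro sorted_wrt_concat) (auto simp: sorted_wrt_map)
  then have "sorted_wrt (<) (map f ?ys)"
    by (simp only: sorted_wrt_map)
  then have "sorted (map f ?ys)" "distinct ?ys"
    by (simp_all only: strict_sorted_iff distinct_map)
  moreover have "set ?ys = S" using fin by (auto simp: set_F)
  ultimately show ?thesis using idem_if_sorted_distinct[of ?ys] by simp
qed

text \<open>Otherwise the \<open>l\<close> rows from \<open>a\<close> to \<open>a + (l - 1)\<close>
  all have one length by monotonicity, and regularity fails.\<close>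

lemma row_length_decreases:
  assumes reg: "regular_partition l \<mu>" and l: "2 \<le> l" and a: "1 \<le> a" "a \<le> length \<mu>"
  shows "row_length \<mu> (a + (l - 1)) < row_length \<mu> a"
proof (rule ccontr)
  assume ge: "\<not> ?thesis"
  have p: "partition \<mu>" using reg by (simp add: regular_partition_def)
  have in_set: "row_length \<mu> a \<in> set \<mu>" using a by (simp add: row_length_def)
  then have pos: "0 < row_length \<mu> a"
    using p by (metis gr0I partition_def)
  \<comment> \<open>\<open>row_length\<close> is 0 outside the list, so a positive value means a
    genuine row.\<close>
  then have len: "a + (l - 1) \<le> length \<mu>"
    using ge row_length_pos[of \<mu> "a + (l - 1)"] by simp
  have "\<mu> ! j = row_length \<mu> a" if j: "a - 1 \<le> j" "j < a - 1 + l" for j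
  proof -
    have "row_length \<mu> (a + (l - 1)) \<le> row_length \<mu> (Suc j)"
      "row_length \<mu> (Suc j) \<le> row_length \<mu> a"
      using j a by (auto intro!: row_length_antimono p)
    then have "row_length \<mu> (Suc j) = row_length \<mu> a" using ge by simp
    then show ?thesis using j a len l by (auto simp: row_length_def split: if_splits)
  qed
  then have "{a - 1..<a - 1 + l} \<subseteq> {j. j < length \<mu> \<and> row_length \<mu> a = \<mu> ! j}"
    using len a l by auto
  then have "card {a - 1..<a - 1 + l} \<le> card {j. j < length \<mu> \<and> row_length \<mu> a = \<mu> ! j}"
    by (intro card_mono) auto
  then have "l \<le> count_list \<mu> (row_length \<mu> a)"
    by (simp add: count_list_eq_length_filter length_filter_conv_card)
  then show False using reg in_set by (auto simp: regular_partition_def)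
qed

lemma row_length_growth:
  assumes reg: "regular_partition l \<mu>" and l: "2 \<le> l"
    and "1 \<le> a" "a + k \<le> length \<mu> + 1"
  shows "int k \<le> (int l - 1) * (int (row_length \<mu> a) - int (row_length \<mu> (a + k))) + int l - 2"
  using assms(3,4)
proof (induction k arbitrary: a rule: less_induct)
  case (less k)
  show ?case
  proof (cases "k < l - 1")
    case True
    have "row_length \<mu> (a + k) \<le> row_length \<mu> a"
      using reg less.prems by (intro row_length_antimono) (auto simp: regular_partition_def)
    then have "0 \<le> (int l - 1) * (int (row_length \<mu> a) - int (row_length \<mu> (a + k)))"
      using l by simp
    then show ?thesis using True by linarith
  next
    case False
    define a' k' where "a' = a + (l - 1)" and "k' = k - (l - 1)"
    have k: "a' + k' = a + k" "int k' = int k - (int l - 1)"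
      using False l by (auto simp: a'_def k'_def)
    have "int k' \<le> (int l - 1) * (int (row_length \<mu> a') - int (row_length \<mu> (a + k))) + int l - 2"
      using less.IH[of k' a'] less.prems False l k by (simp add: a'_def k'_def)
    \<comment> \<open>Here \<open>k \<ge> l - 1 \<ge> 1\<close>, so
      \<open>a \<le> length \<mu>\<close> although \<open>a + k\<close> may be the empty
      row.\<close>
    moreover have "row_length \<mu> a' < row_length \<mu> a"
      unfolding a'_def using False less.prems l by (intro row_length_decreases reg) auto
    then have "(int l - 1) * (int (row_length \<mu> a') - int (row_length \<mu> (a + k)))
        \<le> (int l - 1) * (int (row_length \<mu> a) - int (row_length \<mu> (a + k)) - 1)"
      using l by (intro mult_left_mono) auto
    ultimately show ?thesis using k by (simp add: algebra_simps)
  qed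
qed

text \<open>Removing the box shortens row \<open>a\<close> by one, leaves row \<open>a + 1\<close>
  as it was, and still gives a partition.\<close>

lemma row_length_below_removable:
  assumes "removable \<mu> (a, b)"
  shows "row_length \<mu> (a + 1) < row_length \<mu> a"
proof -
  from assms obtain \<nu> where \<nu>: "(a, b) \<in> diagram \<mu>" "partition \<nu>"
    "diagram \<nu> = diagram \<mu> - {(a, b)}" by (auto simp: removable_def)
  then have "(a, b) \<notin> diagram \<nu>" "insert (a, b) (diagram \<nu>) = diagram \<mu>" by auto
  note box = diagram_box_unique[OF this(1) refl this(2), simplified]
  have "1 \<le> a" using removable_box(2)[OF assms] .
  then have "row_length \<nu> (a + 1) \<le> row_length \<nu> a"
    using \<nu>(2) by (intro row_length_antimono) auto
  then show ?thesis using box by simp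
qed

lemma ladder_number_mono_signature_boxes:
  assumes reg: "regular_partition l \<mu>" and l: "2 \<le> l"
    and x: "(a, b) \<in> signature_boxes l i \<mu>" and y: "(c, d) \<in> signature_boxes l i \<mu>"
    and ac: "a < c"
  shows "ladder_number l (c, d) \<le> ladder_number l (a, b)"
proof (rule ccontr)
  assume "\<not> ?thesis"
  then have "int a + int (l - 1) * int b < int c + int (l - 1) * int d"
    unfolding ladder_number_def by (simp flip: of_nat_mult of_nat_add)
  then have gt: "(int l - 1) * (int b - int d) < int c - int a"
    using l by (simp add: algebra_simps)
  have "int l dvd (int b - int a) - (int d - int c)"
    using x y unfolding mod_eq_dvd_iff[symmetric] by (simp add: signature_boxes_def residue_def)
  then obtain m where m: "(int b - int d) + (int c - int a) = int l * m"
    by (metis diff_diff_eq2 diff_add_eq add_diff_eq dvdE)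
  \<comment> \<open>Adding \<open>b - d\<close> to both sides of \<open>gt\<close> turns the right
    side into a multiple of \<open>l\<close>, so the strict inequality has a gap of at least
    \<open>l\<close>.\<close>
  have "int l * (int b - int d) < int l * m"
    using gt m by (simp add: algebra_simps)
  then have "int b - int d + 1 \<le> m" using l by (simp add: mult_less_cancel_left)
  then have "int l * (int b - int d + 1) \<le> int l * m" by (intro mult_left_mono) auto
  then have far: "(int l - 1) * (int b - int d) + int l \<le> int c - int a"
    using m by (simp add: algebra_simps)
  have a: "1 \<le> a" using x by (auto simp: signature_boxes_def dest: addable_box removable_box)
  have c: "c \<le> length \<mu> + 1" and d: "int d \<le> int (row_length \<mu> c) + 1"
    using y by (auto simp: signature_boxes_def dest: addable_box removable_box)
  have mono: "(int l - 1) * s \<le> (int l - 1) * t" if "s \<le> t" for s t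
    using that l by (intro mult_left_mono) auto
  show False
  proof (cases "removable \<mu> (a, b)")
    case True
    have "row_length \<mu> (a + 1) < b"
      using row_length_below_removable[OF True] removable_box(1)[OF True] by simp
    then have "(int l - 1) * (int (row_length \<mu> (a + 1)) - int (row_length \<mu> c))
        \<le> (int l - 1) * (int b - int d)"
      using d by (intro mono) auto
    \<comment> \<open>Starting at row \<open>a + 1\<close> costs one row, so the bound on
      \<open>c - a\<close> has \<open>l - 1\<close> in place of \<open>l - 2\<close>, still below
      the \<open>l\<close> in \<open>far\<close>.\<close>
    moreover have "int c - int a - 1 \<le>
        (int l - 1) * (int (row_length \<mu> (a + 1)) - int (row_length \<mu> c)) + int l - 2"
      using row_length_growth[OF reg l, of "a + 1" "c - (a + 1)"] ac c by simp
    ultimately show False using far by linarith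
  next
    case False
    then have "b = row_length \<mu> a + 1"
      using x by (auto simp: signature_boxes_def dest: addable_box)
    then have "(int l - 1) * (int (row_length \<mu> a) - int (row_length \<mu> c))
        \<le> (int l - 1) * (int b - int d)"
      using d by (intro mono) auto
    moreover have "int c - int a \<le>
        (int l - 1) * (int (row_length \<mu> a) - int (row_length \<mu> c)) + int l - 2"
      using row_length_growth[OF reg l a, of "c - a"] ac c by simp
    ultimately show False using far by linarith
  qed
qed

text \<open>Signature boxes have positive coordinates, so the positivity conditions in
  \<open>ladder\<close> exclude none of them.\<close>

lemma signature_boxes_Int_ladder:
  "signature_boxes l i \<mu> \<inter> ladder l n = {x \<in> signature_boxes l i \<mu>. ladder_number l x = n}"
proof -
  have "1 \<le> a \<and> 1 \<le> b" if "(a, b) \<in> signature_boxes l i \<mu>" for a b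
  proof (cases "addable \<mu> (a, b)")
    case True
    then show ?thesis using addable_box[of \<mu> a b] by simp
  next
    case False
    then have "(a, b) \<in> diagram \<mu>"
      using that by (simp add: signature_boxes_def removable_def)
    then show ?thesis by (simp add: diagram_def)
  qed
  then show ?thesis by (auto simp: ladder_def)
qed

theorem theorem9p3:
  fixes l :: nat and i :: int and \<mu> :: "nat list"
  assumes "l \<ge> 3"
    and "regular_partition l \<mu>"
    and "0 \<le> i" and "i < int l"
  shows "signature l i \<mu> = ladder_word l i \<mu>
    \<and> reduced_signature l i \<mu> = reduced_word (ladder_word l i \<mu>)"
proof -
  let ?S = "signature_boxes l i \<mu>"
  have l: "2 \<le> l" using assms(1) by simp
  have "inj_on (\<lambda>x. - int (fst x)) ?S"
    using inj_on_row_signature_boxes[OF l, of i \<mu>] by (simp add: inj_on_def)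
  \<comment> \<open>The key is the negated row, so \<open>y\<close> is the upper box and takes the
    role of \<open>(a, b)\<close>.\<close>
  moreover have "ladder_number l x \<le> ladder_number l y"
    if "x \<in> ?S" "y \<in> ?S" "- int (fst x) < - int (fst y)" for x y
    using that ladder_number_mono_signature_boxes[OF assms(2) l, of "fst y" "snd y" i "fst x" "snd x"]
    by simp
  ultimately have "bottom_to_top ?S = concat (map (\<lambda>n. bottom_to_top (?S \<inter> ladder l n))
      (sorted_list_of_set (ladder_number l ` ?S)))"
    unfolding bottom_to_top_def signature_boxes_Int_ladder
    by (intro sorted_key_list_of_set_fibres finite_signature_boxes)
  then have "signature l i \<mu> = ladder_word l i \<mu>"
    by (simp add: signature_def ladder_word_def map_concat comp_def)
  then show ?thesis by (simp add: reduced_signature_def)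
qed

end
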